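(* Let $T:L_2\to L_2$ be a bounded linear operator. Then $T$ is narrow if and only if for each measurable set $A\subseteq[0,1]$ of positive measure the restriction $T|_{L_2(A)}$ is not an isomorphic embedding.
   Context: Here $L_2=L_2[0,1]$ with respect to Lebesgue measure $\mu$ on $[0,1]$, and the scalars may be real or complex. For a measurable set $A\subseteq[0,1]$, $L_2(A)$ denotes the subspace of $L_2$ consisting of the functions that vanish a.e. outside $A$. A bounded linear operator $S:E\to F$ between normed spaces is an isomorphic embedding if there is $c>0$ with $\|Sx\|\ge c\|x\|$ for all $x\in E$. A sign is a measurable function on $[0,1]$ with values in $\{1,-1,0\}$; its support $\operatorname{supp} x$ is the set where it is nonzero (sets and functions being identified up to null sets). An operator $T:L_2\to L_2$ is narrow if for every $\varepsilon>0$ and every measurable set $A\subseteq[0,1]$ there exists a sign $x\in L_2$ with $\operatorname{supp} x=A$ and $\int x\,d\mu=0$ such that $\|Tx\|<\varepsilon$.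
   Formalization: For complex scalars only "narrow implies no restriction is an isomorphic embedding" is stated; the converse is false there (the projection onto the span of e^{2πint}, n<0, is a counterexample, as signs are real-valued). For real scalars the full equivalence is stated. *)

theory Defs
  imports "HOL-Analysis.Analysis"
begin

section \<open>The normed space $L_2[0,1]$\<close>

text \<open>The scalar field is the type variable; it is meant to be instantiated by \<^typ>\<open>real\<close> or
  \<^typ>\<open>complex\<close>. Functions have domain \<^typ>\<open>real\<close>, but only their values on $[0,1]$ matter.\<close>

abbreviation unit_leb :: "real measure" where
  "unit_leb \<equiv> lebesgue_on {0..1}"

definition square_integrable :: "(real \<Rightarrow> 'a::{real_normed_field,banach,second_countable_topology}) \<Rightarrow> bool" where
  "square_integrable f \<longleftrightarrow>
     f \<in> borel_measurable unit_leb \<and> integrable unit_leb (\<lambda>t. (norm (f t))\<^sup>2)"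

definition ae_eq :: "(real \<Rightarrow> 'a::{real_normed_field,banach,second_countable_topology}) \<Rightarrow> (real \<Rightarrow> 'a) \<Rightarrow> bool" where
  "ae_eq f g \<longleftrightarrow> square_integrable f \<and> square_integrable g \<and> (AE t in unit_leb. f t = g t)"

definition l2norm :: "(real \<Rightarrow> 'a::{real_normed_field,banach,second_countable_topology}) \<Rightarrow> real" where
  "l2norm f = sqrt (integral\<^sup>L unit_leb (\<lambda>t. (norm (f t))\<^sup>2))"

lemma square_integrable_0: "square_integrable (\<lambda>_. 0)"
  by (simp add: square_integrable_def)

lemma square_integrable_mult:
  assumes "square_integrable f"
  shows "square_integrable (\<lambda>t. c * f t)"
  using assms by (auto simp: square_integrable_def norm_mult power_mult_distrib)

lemma square_integrable_scaleR:
  assumes "square_integrable f"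
  shows "square_integrable (\<lambda>t. r *\<^sub>R f t)"
  using assms by (auto simp: square_integrable_def power_mult_distrib)

lemma square_norm_add_le:
  fixes x y :: "'a::real_normed_vector"
  assumes "s > 0"
  shows "(norm (x + y))\<^sup>2 \<le> (1 + s) * (norm x)\<^sup>2 + (1 + 1 / s) * (norm y)\<^sup>2"
proof -
  have "0 \<le> (s * norm x - norm y)\<^sup>2 / s"
    using assms by simp
  also have "\<dots> = s * (norm x)\<^sup>2 + (1 / s) * (norm y)\<^sup>2 - 2 * norm x * norm y"
    using assms by (simp add: field_simps power2_eq_square)
  finally have "(norm x + norm y)\<^sup>2 \<le> (1 + s) * (norm x)\<^sup>2 + (1 + 1 / s) * (norm y)\<^sup>2"
    by (simp add: algebra_simps power2_eq_square)
  moreover have "(norm (x + y))\<^sup>2 \<le> (norm x + norm y)\<^sup>2"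
    by (intro power_mono norm_triangle_ineq norm_ge_zero)
  ultimately show ?thesis by linarith
qed

lemma square_integrable_add:
  assumes f: "square_integrable f" and g: "square_integrable g"
  shows "square_integrable (\<lambda>t. f t + g t)"
proof -
  have [measurable]: "f \<in> borel_measurable unit_leb" "g \<in> borel_measurable unit_leb"
    using f g by (auto simp: square_integrable_def)
  have "integrable unit_leb (\<lambda>t. 2 * (norm (f t))\<^sup>2 + 2 * (norm (g t))\<^sup>2)"
    using f g by (auto simp: square_integrable_def)
  then have "integrable unit_leb (\<lambda>t. (norm (f t + g t))\<^sup>2)"
    by (rule Bochner_Integration.integrable_bound)
       (use square_norm_add_le[of 1] in auto)
  then show ?thesis by (simp add: square_integrable_def)
qed

lemma square_integrable_diff:
  assumes "square_integrable f" "square_integrable g"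
  shows "square_integrable (\<lambda>t. f t - g t)"
  using square_integrable_add[OF assms(1) square_integrable_scaleR[OF assms(2), of "-1"]] by simp

lemma l2norm_sq: "(l2norm f)\<^sup>2 = integral\<^sup>L unit_leb (\<lambda>t. (norm (f t))\<^sup>2)"
  by (simp add: l2norm_def)

lemma l2norm_nonneg: "0 \<le> l2norm f"
  by (simp add: l2norm_def)

lemma l2norm_eq_0:
  assumes "square_integrable f"
  shows "l2norm f = 0 \<longleftrightarrow> (AE t in unit_leb. f t = 0)"
  using assms by (simp add: l2norm_def square_integrable_def integral_nonneg_eq_0_iff_AE)

lemma l2norm_cong:
  assumes "ae_eq f g"
  shows "l2norm f = l2norm g"
proof -
  have "f \<in> borel_measurable unit_leb" "g \<in> borel_measurable unit_leb" "AE t in unit_leb. f t = g t"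
    using assms by (auto simp: ae_eq_def square_integrable_def)
  then have "integral\<^sup>L unit_leb (\<lambda>t. (norm (f t))\<^sup>2) = integral\<^sup>L unit_leb (\<lambda>t. (norm (g t))\<^sup>2)"
    by (intro integral_cong_AE) auto
  then show ?thesis by (simp add: l2norm_def)
qed

lemma l2norm_triangle:
  assumes f: "square_integrable f" and g: "square_integrable g"
  shows "l2norm (\<lambda>t. f t + g t) \<le> l2norm f + l2norm g"
proof (cases "l2norm f = 0 \<or> l2norm g = 0")
  case True
  then consider "AE t in unit_leb. f t = 0" | "AE t in unit_leb. g t = 0"
    using l2norm_eq_0 f g by blast
  then have "ae_eq (\<lambda>t. f t + g t) g \<or> ae_eq (\<lambda>t. f t + g t) f"
    by cases (use f g square_integrable_add[OF f g] in \<open>auto simp: ae_eq_def\<close>)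
  then show ?thesis
    using l2norm_cong l2norm_nonneg[of f] l2norm_nonneg[of g] by fastforce
next
  case False
  let ?a = "l2norm f" and ?b = "l2norm g"
  have pos: "?a > 0" "?b > 0"
    using False l2norm_nonneg[of f] l2norm_nonneg[of g] by auto
  define s where "s = ?b / ?a"
  have s: "s > 0" using pos by (simp add: s_def)
  have int: "integrable unit_leb (\<lambda>t. (norm (f t))\<^sup>2)" "integrable unit_leb (\<lambda>t. (norm (g t))\<^sup>2)"
    using f g by (auto simp: square_integrable_def)
  have "(l2norm (\<lambda>t. f t + g t))\<^sup>2 \<le>
      integral\<^sup>L unit_leb (\<lambda>t. (1 + s) * (norm (f t))\<^sup>2 + (1 + 1 / s) * (norm (g t))\<^sup>2)"
    unfolding l2norm_sq
    by (rule integral_mono)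
       (use square_integrable_add[OF f g] int square_norm_add_le[OF s] in \<open>auto simp: square_integrable_def\<close>)
  also have "\<dots> = (1 + s) * ?a\<^sup>2 + (1 + 1 / s) * ?b\<^sup>2"
    using int by (simp add: l2norm_sq)
  also have "\<dots> = (?a + ?b)\<^sup>2"
    using pos by (simp add: s_def field_simps power2_eq_square)
  finally show ?thesis
    by (rule power2_le_imp_le) (use pos in simp)
qed

lemma part_equivp_ae_eq: "part_equivp ae_eq"
proof (rule part_equivpI)
  show "\<exists>x. ae_eq x x" by (rule exI[of _ "\<lambda>_. 0"]) (simp add: ae_eq_def square_integrable_0)
  show "symp ae_eq" by (auto simp: symp_def ae_eq_def elim: AE_mp)
  show "transp ae_eq" by (auto simp: transp_def ae_eq_def elim: AE_mp)
qed

quotient_type (overloaded) 'a l2 =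
    "real \<Rightarrow> 'a::{real_normed_field,banach,second_countable_topology}" / partial: ae_eq
  by (rule part_equivp_ae_eq)

instantiation l2 :: ("{real_normed_field,banach,second_countable_topology}") real_normed_vector
begin

lift_definition zero_l2 :: "'a l2" is "\<lambda>_. 0"
  by (simp add: ae_eq_def square_integrable_0)

lift_definition plus_l2 :: "'a l2 \<Rightarrow> 'a l2 \<Rightarrow> 'a l2" is "\<lambda>f g t. f t + g t"
  by (auto simp: ae_eq_def intro: square_integrable_add)

lift_definition minus_l2 :: "'a l2 \<Rightarrow> 'a l2 \<Rightarrow> 'a l2" is "\<lambda>f g t. f t - g t"
  by (auto simp: ae_eq_def intro: square_integrable_diff)

lift_definition uminus_l2 :: "'a l2 \<Rightarrow> 'a l2" is "\<lambda>f t. - f t"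
  using square_integrable_scaleR[of _ "-1"] by (auto simp: ae_eq_def)

lift_definition scaleR_l2 :: "real \<Rightarrow> 'a l2 \<Rightarrow> 'a l2" is "\<lambda>r f t. r *\<^sub>R f t"
  by (auto simp: ae_eq_def intro: square_integrable_scaleR)

lift_definition norm_l2 :: "'a l2 \<Rightarrow> real" is l2norm
  by (rule l2norm_cong)

definition sgn_l2 :: "'a l2 \<Rightarrow> 'a l2" where "sgn_l2 x = inverse (norm x) *\<^sub>R x"
definition dist_l2 :: "'a l2 \<Rightarrow> 'a l2 \<Rightarrow> real" where "dist_l2 x y = norm (x - y)"
definition uniformity_l2 :: "('a l2 \<times> 'a l2) filter" where
  "uniformity_l2 = (INF e\<in>{0<..}. principal {(x, y). dist x y < e})"
definition open_l2 :: "'a l2 set \<Rightarrow> bool" where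
  "open_l2 U = (\<forall>x\<in>U. \<forall>\<^sub>F (x', y) in uniformity. x' = x \<longrightarrow> y \<in> U)"

instance
proof
  fix a b c x y :: "'a l2" and r s :: real
  show "a + b + c = a + (b + c)"
    by transfer (auto simp: ae_eq_def add.assoc intro!: square_integrable_add)
  show "a + b = b + a"
    by transfer (auto simp: ae_eq_def add.commute intro!: square_integrable_add)
  show "0 + a = a"
    by transfer (auto simp: ae_eq_def)
  show "- a + a = 0"
    by transfer (auto simp: ae_eq_def square_integrable_0)
  show "a - b = a + - b"
    by transfer (auto simp: ae_eq_def intro!: square_integrable_diff)
  show "r *\<^sub>R (x + y) = r *\<^sub>R x + r *\<^sub>R y"
    by transfer
       (auto simp: ae_eq_def scaleR_add_right intro!: square_integrable_add square_integrable_scaleR)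
  show "(r + s) *\<^sub>R x = r *\<^sub>R x + s *\<^sub>R x"
    by transfer
       (auto simp: ae_eq_def scaleR_add_left intro!: square_integrable_add square_integrable_scaleR)
  show "r *\<^sub>R s *\<^sub>R x = (r * s) *\<^sub>R x"
    by transfer (auto simp: ae_eq_def intro!: square_integrable_scaleR)
  show "1 *\<^sub>R x = x"
    by transfer (auto simp: ae_eq_def)
  show "norm x = 0 \<longleftrightarrow> x = 0"
    by transfer (auto simp: ae_eq_def l2norm_eq_0 square_integrable_0)
  show "norm (x + y) \<le> norm x + norm y"
    by transfer (auto simp: ae_eq_def intro!: l2norm_triangle)
  show "norm (r *\<^sub>R x) = \<bar>r\<bar> * norm x"
    by transfer (simp add: l2norm_def power_mult_distrib real_sqrt_mult)
qed (simp_all add: sgn_l2_def dist_l2_def uniformity_l2_def open_l2_def)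

end

lift_definition scale_l2 :: "'a \<Rightarrow> 'a l2 \<Rightarrow> 'a::{real_normed_field,banach,second_countable_topology} l2"
  is "\<lambda>c f t. c * f t"
  by (auto simp: ae_eq_def intro: square_integrable_mult)

lift_definition vanishes_outside :: "'a::{real_normed_field,banach,second_countable_topology} l2 \<Rightarrow> real set \<Rightarrow> bool"
  is "\<lambda>f A. AE t in unit_leb. t \<notin> A \<longrightarrow> f t = 0"
proof (rule ext)
  fix f g :: "real \<Rightarrow> 'a" and A :: "real set"
  assume "ae_eq f g"
  then have eq: "AE t in unit_leb. f t = g t" by (simp add: ae_eq_def)
  show "(AE t in unit_leb. t \<notin> A \<longrightarrow> f t = 0) = (AE t in unit_leb. t \<notin> A \<longrightarrow> g t = 0)"
  proof
    assume "AE t in unit_leb. t \<notin> A \<longrightarrow> f t = 0"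
    with eq show "AE t in unit_leb. t \<notin> A \<longrightarrow> g t = 0" by eventually_elim simp
  next
    assume "AE t in unit_leb. t \<notin> A \<longrightarrow> g t = 0"
    with eq show "AE t in unit_leb. t \<notin> A \<longrightarrow> f t = 0" by eventually_elim simp
  qed
qed

definition L2_on :: "real set \<Rightarrow> 'a::{real_normed_field,banach,second_countable_topology} l2 set" where
  "L2_on A = {x. vanishes_outside x A}"

section \<open>Operators\<close>

text \<open>Bounded operators are linear over the scalar field, not merely over the reals.\<close>

definition bounded_operator ::
    "('a::{real_normed_field,banach,second_countable_topology} l2 \<Rightarrow> 'a l2) \<Rightarrow> bool" where
  "bounded_operator T \<longleftrightarrow> bounded_linear T \<and> (\<forall>c x. T (scale_l2 c x) = scale_l2 c (T x))"

text \<open>To be applied to (the restriction to a subspace of) a bounded linear operator.\<close>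

definition isomorphic_embedding_on ::
    "'e::real_normed_vector set \<Rightarrow> ('e \<Rightarrow> 'f::real_normed_vector) \<Rightarrow> bool" where
  "isomorphic_embedding_on E S \<longleftrightarrow> (\<exists>c>0. \<forall>x\<in>E. norm (S x) \<ge> c * norm x)"

definition is_sign :: "(real \<Rightarrow> 'a::{real_normed_field,banach,second_countable_topology}) \<Rightarrow> bool" where
  "is_sign f \<longleftrightarrow> f \<in> borel_measurable unit_leb \<and> (\<forall>t\<in>{0..1}. f t \<in> {1, -1, 0})"

lemma is_sign_square_integrable:
  assumes "is_sign f"
  shows "square_integrable f"
proof -
  have [measurable]: "f \<in> borel_measurable unit_leb" using assms by (simp add: is_sign_def)
  have "integrable unit_leb (\<lambda>t. (norm (f t))\<^sup>2)"
  proof (rule Bochner_Integration.integrable_bound[of _ "\<lambda>_. 1 :: real"])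
    show "integrable unit_leb (\<lambda>_. 1 :: real)"
      by (simp add: integrable_restrict_space lebesgue_on_UNIV_eq)
    show "AE t in unit_leb. norm ((norm (f t))\<^sup>2) \<le> norm (1 :: real)"
    proof (rule AE_I2)
      fix t assume "t \<in> space unit_leb"
      then have "f t \<in> {1, -1, 0}" using assms by (auto simp: is_sign_def space_restrict_space)
      then show "norm ((norm (f t))\<^sup>2) \<le> norm (1 :: real)" by auto
    qed
  qed simp
  then show ?thesis by (simp add: square_integrable_def)
qed

text \<open>The support of a sign is compared with the given set up to null sets. Signs are real-valued also
  over the complex scalars. For this reason an operator on complex $L_2$ that is not an isomorphic
  embedding on any $L_2(A)$ need not be narrow: take the orthogonal projection onto the closed span
  of $e^{2 \pi i n t}$, $n < 0$, which maps each mean zero sign with support $[0,1]$ to a function of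
  norm $1/\sqrt{2}$.\<close>

definition narrow ::
    "('a::{real_normed_field,banach,second_countable_topology} l2 \<Rightarrow> 'a l2) \<Rightarrow> bool" where
  "narrow T \<longleftrightarrow> (\<forall>\<epsilon>>0. \<forall>A\<in>sets unit_leb. \<exists>f.
     is_sign f \<and> (AE t in unit_leb. f t \<noteq> 0 \<longleftrightarrow> t \<in> A) \<and>
     integral\<^sup>L unit_leb f = 0 \<and> norm (T (abs_l2 f)) < \<epsilon>)"

end

theory Submission
  imports Defs
begin

text \<open>
  That a narrow operator is bounded below on no $L_2(A)$ is immediate, because a sign with support
  $A$ has norm $\sqrt{\mu(A)}$.

  For the converse the scalars are real. Fix $A$ and $\delta > 0$, and let $D$ be the set of all $x \in L_2(A)$ with
  $|x| \le 1$ and mean zero. A point of $D$ is a mean zero sign with support $A$ as soon as $|x| = 1$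
  almost everywhere on $A$. If this fails at $x$, then $|x| \le 1 - \eta$ on a set $B \subseteq A$ of
  positive measure for some $\eta > 0$, and since $T$ is not bounded below on the subspaces $L_2(C)$
  with $C \subseteq B$ of positive measure, there is a nonzero step $s$, living on $B$ and bounded by $\eta$, with mean
  zero and $\|Ts\| \le \delta \|s\|$; then $x \pm s \in D$
  (\<open>bounded_mean_zero_almost_kernel\<close>). Move from $x$ to $x + s$ or $x - s$ according to a fair
  coin. By the parallelogram law the mean of $\|x\|^2$ grows by $\|s\|^2$, and the mean of $\|Tx\|^2$
  by $\|Ts\|^2 \le \delta^2 \|s\|^2$. Since $\|x\| \le 1$ on $D$, a walk that starts at $0$
  keeps the mean of $\|Tx\|^2$ at most $\delta^2$; being a bounded martingale it converges, and a
  walk with steps as long as possible cannot stop before it reaches a sign.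

  No random walk is constructed. Its role is taken by its value function, the \<open>potential\<close>: the least
  nonnegative function $g$ on $D$ with
  $\|s\|^2 + \frac{1}{2}(g(x + s) + g(x - s)) \le g(x)$ for all steps, which is the
  supremum of the mean squared length that a walk from $x$ can still collect. Minimality of the
  potential says that a walk can be continued until hardly anything is left to collect, while any
  function that does not increase in the mean stays under control (\<open>stopping\<close>). Applied repeatedly
  this yields a Cauchy sequence in $D$ with small images under $T$ along which the potential tends to
  zero, so that the steps available at its members become arbitrarily short
  (\<open>exhausted_sequence\<close>). The limit is a sign: otherwise infinitely many members would admit one
  and the same nonzero step (\<open>mean_zero_sign_with_small_image\<close>).
\<close>

section \<open>Walks with steps that an operator almost annihilates\<close>

text \<open>The set \<open>D\<close> is the region that the walk must not leave. The two parallelogram laws make the domain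
  and the codomain Euclidean without the choice of an inner product.\<close>

locale coin_walk =
  fixes T :: "'v::real_normed_vector \<Rightarrow> 'w::real_normed_vector" and \<delta> :: real and D :: "'v set"
  assumes lin: "bounded_linear T"
    and delta: "\<delta> > 0"
    and zero: "0 \<in> D"
    and bounded: "x \<in> D \<Longrightarrow> norm x \<le> 1"
    and parallelogram_domain: "(norm (x + s))\<^sup>2 + (norm (x - s))\<^sup>2 = 2 * (norm x)\<^sup>2 + 2 * (norm (s::'v))\<^sup>2"
    and parallelogram_codomain: "(norm (u + v))\<^sup>2 + (norm (u - v))\<^sup>2 = 2 * (norm u)\<^sup>2 + 2 * (norm (v::'w))\<^sup>2"
begin

text \<open>Both signs of a step are allowed, so that the coin may decide between them.\<close>

definition steps :: "'v \<Rightarrow> 'v set" where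
  "steps x = {s. x + s \<in> D \<and> x - s \<in> D \<and> norm (T s) \<le> \<delta> * norm s}"

text \<open>The number \<open>a\<close> is a reward per unit of squared length, collected while the mean of \<open>g\<close> drops.
  It may be negative; for \<open>a = 0\<close> these are the functions that do not increase in the mean.\<close>

definition supersolution :: "real \<Rightarrow> ('v \<Rightarrow> real) \<Rightarrow> bool" where
  "supersolution a g \<longleftrightarrow>
     (\<forall>x\<in>D. \<forall>s\<in>steps x. a * (norm s)\<^sup>2 + (g (x + s) + g (x - s)) / 2 \<le> g x)"

text \<open>The pointwise infimum of all nonnegative supersolutions with reward one is again one of them, hence
  the least one.\<close>

definition potential :: "'v \<Rightarrow> real" where
  "potential x = Inf {g x | g. supersolution 1 g \<and> (\<forall>y\<in>D. 0 \<le> g y)}"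

lemma supersolutionD:
  "supersolution a g \<Longrightarrow> x \<in> D \<Longrightarrow> s \<in> steps x \<Longrightarrow>
    a * (norm s)\<^sup>2 + (g (x + s) + g (x - s)) / 2 \<le> g x"
  by (auto simp: supersolution_def)

lemma supersolution_add:
  assumes "supersolution a f" "supersolution b g"
  shows "supersolution (a + b) (\<lambda>x. f x + g x)"
  unfolding supersolution_def
proof (intro ballI)
  fix x s assume "x \<in> D" "s \<in> steps x"
  from supersolutionD[OF assms(1) this] supersolutionD[OF assms(2) this]
  show "(a + b) * (norm s)\<^sup>2 + ((f (x + s) + g (x + s)) + (f (x - s) + g (x - s))) / 2 \<le> f x + g x"
    by (simp add: field_simps)
qed

lemma supersolution_cmult:
  assumes "supersolution a f" "0 \<le> c"
  shows "supersolution (c * a) (\<lambda>x. c * f x)"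
  unfolding supersolution_def
proof (intro ballI)
  fix x s assume "x \<in> D" "s \<in> steps x"
  from mult_left_mono[OF supersolutionD[OF assms(1) this] assms(2)]
  show "c * a * (norm s)\<^sup>2 + (c * f (x + s) + c * f (x - s)) / 2 \<le> c * f x"
    by (simp add: field_simps)
qed

lemma potential_le:
  assumes "supersolution 1 g" "\<And>y. y \<in> D \<Longrightarrow> 0 \<le> g y" "x \<in> D"
  shows "potential x \<le> g x"
  unfolding potential_def
  by (rule cInf_lower) (use assms in \<open>auto intro!: bdd_belowI[of _ 0]\<close>)

lemma supersolution_norm: "supersolution 1 (\<lambda>x. 1 - (norm x)\<^sup>2)"
  unfolding supersolution_def
proof (intro ballI)
  fix x s :: 'v
  show "1 * (norm s)\<^sup>2 + (1 - (norm (x + s))\<^sup>2 + (1 - (norm (x - s))\<^sup>2)) / 2 \<le> 1 - (norm x)\<^sup>2"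
    using parallelogram_domain[of x s] by (simp add: field_simps)
qed

lemma supersolution_dist: "supersolution (-1) (\<lambda>x. (norm (x - x0))\<^sup>2)"
  unfolding supersolution_def
proof (intro ballI)
  fix x s :: 'v
  show "(-1) * (norm s)\<^sup>2 + ((norm (x + s - x0))\<^sup>2 + (norm (x - s - x0))\<^sup>2) / 2 \<le> (norm (x - x0))\<^sup>2"
    using parallelogram_domain[of "x - x0" s] by (simp add: algebra_simps)
qed

lemma supersolution_image: "supersolution (-\<delta>\<^sup>2) (\<lambda>x. (norm (T x))\<^sup>2)"
  unfolding supersolution_def
proof (intro ballI)
  fix x s assume "s \<in> steps x"
  then have "(norm (T s))\<^sup>2 \<le> (\<delta> * norm s)\<^sup>2"
    by (intro power_mono) (auto simp: steps_def)
  then show "(-\<delta>\<^sup>2) * (norm s)\<^sup>2 + ((norm (T (x + s)))\<^sup>2 + (norm (T (x - s)))\<^sup>2) / 2 \<le> (norm (T x))\<^sup>2"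
    using parallelogram_codomain[of "T x" "T s"] lin
    by (simp add: power_mult_distrib bounded_linear.linear linear_add linear_diff field_simps)
qed

lemma supersolution_exists:
  "\<exists>g. supersolution 1 g \<and> (\<forall>y\<in>D. 0 \<le> g y)"
  using supersolution_norm bounded by (intro exI[of _ "\<lambda>x. 1 - (norm x)\<^sup>2"]) (auto simp: abs_square_le_1)

lemma potential_greatest:
  assumes "\<And>g. supersolution 1 g \<Longrightarrow> (\<And>y. y \<in> D \<Longrightarrow> 0 \<le> g y) \<Longrightarrow> c \<le> g x"
  shows "c \<le> potential x"
  unfolding potential_def
  by (rule cInf_greatest) (use assms supersolution_exists in auto)

lemma potential_nonneg: "x \<in> D \<Longrightarrow> 0 \<le> potential x"
  by (rule potential_greatest) auto

lemma supersolution_potential: "supersolution 1 potential"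
  unfolding supersolution_def
proof (intro ballI potential_greatest)
  fix x s g assume *: "x \<in> D" "s \<in> steps x" "supersolution 1 g" "\<And>y. y \<in> D \<Longrightarrow> 0 \<le> g y"
  then have "x + s \<in> D" "x - s \<in> D" by (auto simp: steps_def)
  then have "potential (x + s) \<le> g (x + s)" "potential (x - s) \<le> g (x - s)"
    using *(3,4) by (auto intro: potential_le)
  then show "1 * (norm s)\<^sup>2 + (potential (x + s) + potential (x - s)) / 2 \<le> g x"
    using supersolutionD[OF *(3,1,2)] by (simp add: field_simps)
qed

lemma step_le_potential:
  assumes "x \<in> D" "s \<in> steps x"
  shows "(norm s)\<^sup>2 \<le> potential x"
  using supersolutionD[OF supersolution_potential assms] potential_nonneg[of "x + s"] potential_nonneg[of "x - s"] assms
  by (auto simp: steps_def field_simps)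

text \<open>If the conclusion failed, then \<open>potential + F - (F x0 + e)\<close> would be a nonnegative
  supersolution with reward one whose value at \<open>x0\<close> is below the potential there, against minimality.
  In the picture of the walk, \<open>y\<close> is one of the points where a nearly optimal walk from \<open>x0\<close> is
  stopped: on average nothing is left to collect there, and \<open>F\<close> has not grown.\<close>

lemma stopping:
  assumes F: "supersolution 0 F" and x0: "x0 \<in> D" and e: "e > 0"
  shows "\<exists>y\<in>D. potential y + F y < F x0 + e"
proof (rule ccontr)
  assume *: "\<not> (\<exists>y\<in>D. potential y + F y < F x0 + e)"
  have "supersolution 1 (\<lambda>y. potential y + F y - (F x0 + e))"
    using supersolution_add[OF supersolution_potential F] by (simp add: supersolution_def field_simps)
  moreover have "0 \<le> potential y + F y - (F x0 + e)" if "y \<in> D" for y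
    using that * by (auto simp: not_less)
  ultimately have "potential x0 \<le> potential x0 + F x0 - (F x0 + e)"
    using x0 by (intro potential_le) auto
  then show False using e by simp
qed

text \<open>The growth of the squared norm of the image is paid for by the potential: the sum of the former and
  \<open>\<delta>\<^sup>2\<close> times the latter does not increase in the mean, and it is at most \<open>\<delta>\<^sup>2\<close> at the origin. The
  weight \<open>M\<close> of this sum is chosen such that the potential at the stopping point is at most \<open>c\<close>.\<close>

lemma initial_point:
  assumes c: "c > 0"
  obtains y where "y \<in> D" "potential y \<le> c" "norm (T y) \<le> 2 * \<delta>"
proof -
  define M where "M = c / (2 * \<delta>\<^sup>2)"
  have M: "M > 0" and M2: "2 * (M * \<delta>\<^sup>2) = c" using c delta by (auto simp: M_def)
  define F where "F = (\<lambda>x. M * ((norm (T x))\<^sup>2 + \<delta>\<^sup>2 * potential x))"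
  have "supersolution (M * (- \<delta>\<^sup>2 + \<delta>\<^sup>2 * 1)) F"
    unfolding F_def using M delta
    by (intro supersolution_cmult supersolution_add supersolution_image supersolution_potential) auto
  then have "supersolution 0 F" by simp
  then obtain y where y: "y \<in> D" "potential y + F y < F 0 + M * \<delta>\<^sup>2"
    using stopping[OF _ zero, of F "M * \<delta>\<^sup>2"] M delta by auto
  have "potential 0 \<le> 1" using potential_le[OF supersolution_norm _ zero] bounded by (auto simp: abs_square_le_1)
  then have "M * (\<delta>\<^sup>2 * potential 0) \<le> M * (\<delta>\<^sup>2 * 1)"
    using M by (intro mult_left_mono) auto
  then have F0: "F 0 \<le> M * \<delta>\<^sup>2"
    using lin by (simp add: F_def bounded_linear.linear linear_0)
  have nn: "0 \<le> M * (\<delta>\<^sup>2 * potential y)" "0 \<le> M * (norm (T y))\<^sup>2" "0 \<le> potential y"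
    using M potential_nonneg[OF y(1)] by auto
  then have "potential y \<le> c"
    using y(2) F0 M2 by (simp add: F_def algebra_simps)
  moreover have "M * (norm (T y))\<^sup>2 \<le> M * (2 * \<delta>\<^sup>2)"
    using y(2) F0 M2 nn by (simp add: F_def algebra_simps)
  then have "(norm (T y))\<^sup>2 \<le> (2 * \<delta>)\<^sup>2"
    using M delta by (simp add: power_mult_distrib) (smt (verit) zero_le_power2)
  then have "norm (T y) \<le> 2 * \<delta>"
    by (rule power2_le_imp_le) (use delta in simp)
  ultimately show ?thesis using that y(1) by blast
qed

text \<open>In the same way the potential pays for the squared distance from \<open>x0\<close>. The factor \<open>1/32\<close> lets
  the potential drop by the factor 16, so that distances in the sequence below shrink by the factor 4.\<close>

lemma later_point:
  assumes x0: "x0 \<in> D" and c: "c > 0" "potential x0 \<le> c"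
  obtains y where "y \<in> D" "potential y \<le> c / 16" "(norm (y - x0))\<^sup>2 \<le> 2 * c"
proof -
  define F where "F = (\<lambda>x. (1/32) * ((norm (x - x0))\<^sup>2 + potential x))"
  have "supersolution ((1/32) * (- 1 + 1)) F"
    unfolding F_def
    by (intro supersolution_cmult supersolution_add supersolution_dist supersolution_potential) auto
  then have "supersolution 0 F" by simp
  then obtain y where y: "y \<in> D" "potential y + F y < F x0 + c / 32"
    using stopping[OF _ x0, of F "c/32"] c by auto
  then have "33 * potential y + (norm (y - x0))\<^sup>2 < 2 * c"
    using c by (simp add: F_def field_simps)
  then show ?thesis
    using c potential_nonneg[OF y(1)] zero_le_power2[of "norm (y - x0)"] by (intro that[of y] y(1)) linarith+
qed

text \<open>Along the sequence the potential decreases geometrically, and it bounds both the distance to the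
  next member and the lengths of the available steps. The first member has a small image; if
  its potential is small enough, the later members are so close that their images are small as well.\<close>

proposition exhausted_sequence:
  obtains y where "\<And>n. y n \<in> D" "Cauchy y" "\<And>n. norm (T (y n)) \<le> 3 * \<delta>"
    "\<And>e. e > 0 \<Longrightarrow> \<exists>N. \<forall>n\<ge>N. \<forall>s\<in>steps (y n). norm s < e"
proof -
  obtain K where K: "K > 0" "\<And>x. norm (T x) \<le> norm x * K"
    using bounded_linear.pos_bounded[OF lin] by blast
  \<comment> \<open>The total displacement after the first point will be at most \<open>4 * b\<close>, which changes the image
    by at most \<open>\<delta>\<close>.\<close>
  define b where "b = \<delta> / (4 * K)"
  define c where "c n = b\<^sup>2 / 16 ^ n" for n :: nat
  have b: "b > 0" using delta K by (simp add: b_def)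
  have c: "c n > 0" for n using b by (simp add: c_def)
  have "\<exists>y. \<forall>n. (y n \<in> D \<and> potential (y n) \<le> c n \<and> (n = 0 \<longrightarrow> norm (T (y n)) \<le> 2 * \<delta>))
      \<and> (norm (y (Suc n) - y n))\<^sup>2 \<le> 2 * c n"
  proof (rule dependent_nat_choice)
    show "\<exists>x. x \<in> D \<and> potential x \<le> c 0 \<and> ((0::nat) = 0 \<longrightarrow> norm (T x) \<le> 2 * \<delta>)"
      using initial_point[OF c] by blast
  next
    fix x n assume "x \<in> D \<and> potential x \<le> c n \<and> (n = 0 \<longrightarrow> norm (T x) \<le> 2 * \<delta>)"
    then obtain y where "y \<in> D" "potential y \<le> c n / 16" "(norm (y - x))\<^sup>2 \<le> 2 * c n"
      using later_point[of x "c n"] c by auto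
    then show "\<exists>y. (y \<in> D \<and> potential y \<le> c (Suc n) \<and> (Suc n = 0 \<longrightarrow> norm (T y) \<le> 2 * \<delta>))
        \<and> (norm (y - x))\<^sup>2 \<le> 2 * c n"
      by (intro exI[of _ y]) (auto simp: c_def)
  qed
  then obtain y where y: "\<And>n. y n \<in> D" "\<And>n. potential (y n) \<le> c n" "norm (T (y 0)) \<le> 2 * \<delta>"
      "\<And>n. (norm (y (Suc n) - y n))\<^sup>2 \<le> 2 * c n"
    by metis
  have step: "norm (y (Suc n) - y n) \<le> 2 * b / 4 ^ n" for n
  proof (rule power2_le_imp_le)
    have "(4 ^ n)\<^sup>2 = (16::real) ^ n" by (simp add: power2_eq_square flip: power_mult_distrib)
    then show "(norm (y (Suc n) - y n))\<^sup>2 \<le> (2 * b / 4 ^ n)\<^sup>2"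
      using y(4)[of n] b
      by (simp add: c_def power_mult_distrib power_divide field_simps) (smt (verit) zero_le_power2)
  qed (use b in simp)
  have dist: "norm (y (m + k) - y m) \<le> 4 * b / 4 ^ m" for m k
  proof -
    have "norm (y (m + k) - y m) \<le> 4 * b / 4 ^ m - 4 * b / 4 ^ (m + k)"
    proof (induction k)
      case (Suc k)
      have "norm (y (m + Suc k) - y m) \<le> norm (y (Suc (m + k)) - y (m + k)) + norm (y (m + k) - y m)"
        using norm_triangle_ineq[of "y (Suc (m + k)) - y (m + k)" "y (m + k) - y m"] by simp
      also have "\<dots> \<le> 4 * b / 4 ^ m - 4 * b / 4 ^ (m + Suc k)"
        using Suc.IH step[of "m + k"] divide_pos_pos[OF b, of "4 ^ (m + k)"] by simp
      finally show ?case .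
    qed (use b in simp)
    then show ?thesis using b by (smt (verit) divide_nonneg_pos zero_less_power)
  qed
  show ?thesis
  proof (rule that)
    show "y n \<in> D" for n by (rule y)
    show "Cauchy y"
    proof (rule CauchyI')
      fix e :: real assume "e > 0"
      have "(\<lambda>m. 4 * b * (1 / 4) ^ m) \<longlonglongrightarrow> 4 * b * 0"
        by (intro tendsto_intros) auto
      then have "\<forall>\<^sub>F m in sequentially. 4 * b * (1 / 4) ^ m < e"
        using \<open>e > 0\<close> by (simp add: order_tendstoD)
      then obtain M where M: "\<And>m. m \<ge> M \<Longrightarrow> 4 * b / 4 ^ m < e"
        by (auto simp: eventually_sequentially power_divide)
      have "dist (y m) (y n) < e" if "m \<ge> M" "m < n" for m n
        using dist[of m "n - m"] M[OF that(1)] that by (simp add: dist_norm norm_minus_commute)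
      then show "\<exists>M. \<forall>m\<ge>M. \<forall>n>m. dist (y m) (y n) < e" by blast
    qed
    show "norm (T (y n)) \<le> 3 * \<delta>" for n
    proof -
      have "norm (T (y n)) \<le> norm (T (y 0)) + norm (T (y n - y 0))"
        using norm_triangle_ineq[of "T (y 0)" "T (y n - y 0)"] lin
        by (simp add: bounded_linear.linear linear_diff)
      also have "norm (T (y n - y 0)) \<le> (4 * b) * K"
        using K(2)[of "y n - y 0"] dist[of 0 n] K(1)
        by (smt (verit) add_0 div_by_1 mult_right_mono power_0)
      also have "(4 * b) * K = \<delta>" using K by (simp add: b_def)
      finally show ?thesis using y(3) by simp
    qed
    fix e :: real assume "e > 0"
    have "(\<lambda>m. b\<^sup>2 * (1 / 16) ^ m) \<longlonglongrightarrow> b\<^sup>2 * 0"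
      by (intro tendsto_intros) auto
    then have "\<forall>\<^sub>F m in sequentially. b\<^sup>2 * (1 / 16) ^ m < e\<^sup>2"
      using \<open>e > 0\<close> by (simp add: order_tendstoD)
    then obtain N where N: "\<And>m. m \<ge> N \<Longrightarrow> c m < e\<^sup>2"
      by (auto simp: eventually_sequentially power_divide c_def)
    have "norm s < e" if "n \<ge> N" "s \<in> steps (y n)" for n s
    proof (rule power2_less_imp_less)
      show "(norm s)\<^sup>2 < e\<^sup>2" using step_le_potential[OF y(1) that(2)] y(2)[of n] N[OF that(1)] by linarith
    qed (use \<open>e > 0\<close> in simp)
    then show "\<exists>N. \<forall>n\<ge>N. \<forall>s\<in>steps (y n). norm s < e" by blast
  qed
qed
end

section \<open>Almost kernel functions in $L_2$\<close>

interpretation unit_leb: finite_measure unit_leb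
  by (rule finite_measure_lebesgue_on) auto

lemma measure_unit_leb_unit_interval: "measure unit_leb {0..1} = 1"
  by (simp add: measure_restrict_space)

lemma ae_eq_refl_iff [simp]: "ae_eq f f \<longleftrightarrow> square_integrable f"
  by (simp add: ae_eq_def)

lemma l2_cases:
  fixes x :: "'a::{real_normed_field,banach,second_countable_topology} l2"
  obtains f where "square_integrable f" "x = abs_l2 f"
  by (induct x rule: l2.abs_induct) auto

lemma abs_l2_eqI:
  assumes "square_integrable f" "square_integrable g" "AE t in unit_leb. f t = g t"
  shows "abs_l2 f = abs_l2 g"
  using Quotient_rel_abs[OF Quotient_l2, of f g] assms by (simp add: ae_eq_def)

lemma abs_l2_algebra:
  assumes "square_integrable f" "square_integrable g"
  shows "abs_l2 f + abs_l2 g = abs_l2 (\<lambda>t. f t + g t)"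
    and "abs_l2 f - abs_l2 g = abs_l2 (\<lambda>t. f t - g t)"
    and "r *\<^sub>R abs_l2 f = abs_l2 (\<lambda>t. r *\<^sub>R f t)"
    and "norm (abs_l2 f) = l2norm f"
  using assms by (simp_all add: plus_l2.abs_eq minus_l2.abs_eq scaleR_l2.abs_eq norm_l2.abs_eq)

lemma l2norm_mono:
  assumes "square_integrable f" "square_integrable g" "AE t in unit_leb. norm (f t) \<le> norm (g t)"
  shows "l2norm f \<le> l2norm g"
  unfolding l2norm_def
  by (intro real_sqrt_le_mono integral_mono_AE)
     (use assms in \<open>auto simp: square_integrable_def power_mono elim!: AE_mp intro!: AE_I2\<close>)

lemma l2_parallelogram:
  fixes x y :: "real l2"
  shows "(norm (x + y))\<^sup>2 + (norm (x - y))\<^sup>2 = 2 * (norm x)\<^sup>2 + 2 * (norm y)\<^sup>2"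
proof -
  obtain f where f: "square_integrable f" "x = abs_l2 f" by (rule l2_cases)
  obtain g where g: "square_integrable g" "y = abs_l2 g" by (rule l2_cases)
  note sq = square_integrable_add[OF f(1) g(1)] square_integrable_diff[OF f(1) g(1)]
  have "(norm (x + y))\<^sup>2 + (norm (x - y))\<^sup>2 =
      (\<integral>t. (norm (f t + g t))\<^sup>2 + (norm (f t - g t))\<^sup>2 \<partial>unit_leb)"
    using f g sq by (simp add: abs_l2_algebra l2norm_sq square_integrable_def)
  also have "(\<lambda>t. (norm (f t + g t))\<^sup>2 + (norm (f t - g t))\<^sup>2) =
      (\<lambda>t. 2 * (norm (f t))\<^sup>2 + 2 * (norm (g t))\<^sup>2)"
    by (auto simp: power2_eq_square algebra_simps)
  also have "integral\<^sup>L unit_leb \<dots> = 2 * (norm x)\<^sup>2 + 2 * (norm y)\<^sup>2"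
    using f g by (simp add: abs_l2_algebra l2norm_sq square_integrable_def)
  finally show ?thesis .
qed

text \<open>The bound is required at every point and not only almost everywhere, so that sums of such functions
  can be estimated pointwise without null sets.\<close>

definition bounded_on :: "real set \<Rightarrow> real \<Rightarrow> (real \<Rightarrow> real) \<Rightarrow> bool" where
  "bounded_on B M f \<longleftrightarrow> f \<in> borel_measurable unit_leb \<and> (\<forall>t. \<bar>f t\<bar> \<le> M * indicator B t)"

lemma bounded_on_bound:
  assumes "bounded_on B M f" "B \<subseteq> B'"
  shows "\<bar>f t\<bar> \<le> \<bar>M\<bar> * indicator B' t"
proof -
  have "\<bar>f t\<bar> \<le> M * indicator B t" using assms by (simp add: bounded_on_def)
  also have "\<dots> \<le> \<bar>M\<bar> * indicator B' t" using assms by (auto simp: indicator_def)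
  finally show ?thesis .
qed

lemma bounded_on_eq_0:
  assumes "bounded_on B M f" "t \<notin> B"
  shows "f t = 0"
  using bounded_on_bound[OF assms(1) order_refl, of t] assms(2) by simp

lemma bounded_on_integrable:
  assumes "bounded_on B M f"
  shows "integrable unit_leb f" "square_integrable f"
proof -
  have b: "\<bar>f t\<bar> \<le> \<bar>M\<bar>" for t
    using bounded_on_bound[OF assms, of UNIV] by simp
  have [measurable]: "f \<in> borel_measurable unit_leb" using assms by (simp add: bounded_on_def)
  show "integrable unit_leb f"
    by (rule unit_leb.integrable_const_bound[where B = "\<bar>M\<bar>"]) (use b in auto)
  have "integrable unit_leb (\<lambda>t. (norm (f t))\<^sup>2)"
    by (rule unit_leb.integrable_const_bound[where B = "\<bar>M\<bar>\<^sup>2"])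
       (use b abs_le_square_iff in \<open>auto simp flip: abs_le_square_iff\<close>)
  then show "square_integrable f" by (simp add: square_integrable_def)
qed

text \<open>Among the pieces that a grid of mesh \<open>1/n\<close> cuts out of \<open>B\<close>, one has positive measure; it cannot
  exhaust \<open>B\<close> when \<open>1/n\<close> is less than the measure of \<open>B\<close>.\<close>

lemma split_positive_measure:
  assumes B: "B \<in> sets unit_leb" "measure unit_leb B > 0"
  obtains C where "C \<in> sets unit_leb" "C \<subseteq> B" "measure unit_leb C > 0" "measure unit_leb (B - C) > 0"
proof -
  obtain n :: nat where n: "n > 0" "1 / real n < measure unit_leb B"
    using B(2) by (metis inverse_eq_divide ex_inverse_of_nat_less)
  define I where "I k = B \<inter> {real k / n .. (real k + 1) / n}" for k
  have I: "I k \<in> sets unit_leb" for k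
  proof -
    have "I k = B \<inter> ({0..1} \<inter> {real k / n .. (real k + 1) / n})"
      using sets.sets_into_space[OF B(1)] by (auto simp: I_def)
    moreover have "{0..1} \<inter> {real k / n .. (real k + 1) / n} \<in> sets unit_leb"
      by (subst sets_restrict_space_iff) auto
    ultimately show ?thesis using B(1) by (metis sets.Int)
  qed
  have small: "measure unit_leb (I k) \<le> 1 / n" for k
  proof -
    have Ik: "I k \<in> sets lebesgue"
      using I[of k] by (subst (asm) sets_restrict_space_iff) auto
    have "measure unit_leb (I k) = measure lebesgue (I k)"
      using sets.sets_into_space[OF I[of k]] by (intro measure_restrict_space) auto
    also have "\<dots> \<le> measure lebesgue {real k / n .. (real k + 1) / n}"
      by (rule measure_mono_fmeasurable) (use Ik in \<open>auto simp: I_def\<close>)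
    also have "\<dots> = 1 / n"
      using n by (simp add: field_simps)
    finally show ?thesis .
  qed
  have cover: "B \<subseteq> (\<Union>k\<le>n. I k)"
  proof
    fix t assume t: "t \<in> B"
    then have t01: "0 \<le> t" "t \<le> 1" using sets.sets_into_space[OF B(1)] by auto
    define k where "k = nat \<lfloor>t * n\<rfloor>"
    have "real k \<le> t * n" "t * n \<le> real k + 1"
      using t01 by (auto simp: k_def)
    moreover have "k \<le> n"
      using \<open>real k \<le> t * n\<close> t01 mult_right_mono[of t 1 "real n"] by simp
    ultimately show "t \<in> (\<Union>k\<le>n. I k)"
      using t n by (auto simp: I_def field_simps intro!: bexI[of _ k])
  qed
  have "\<exists>k\<le>n. measure unit_leb (I k) > 0"
  proof (rule ccontr)
    assume "\<not> ?thesis"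
    then have z: "measure unit_leb (I k) = 0" if "k \<le> n" for k
      using that by (auto simp: not_less intro: antisym)
    have "measure unit_leb B \<le> measure unit_leb (\<Union>k\<le>n. I k)"
      by (rule unit_leb.finite_measure_mono) (use cover I in auto)
    also have "\<dots> \<le> (\<Sum>k\<le>n. measure unit_leb (I k))"
      by (rule unit_leb.finite_measure_subadditive_finite) (use I in auto)
    also have "\<dots> = 0" using z by simp
    finally show False using B by simp
  qed
  then obtain k where k: "measure unit_leb (I k) > 0" by blast
  have "measure unit_leb (B - I k) = measure unit_leb B - measure unit_leb (I k)"
    by (rule unit_leb.finite_measure_Diff) (use B I in \<open>auto simp: I_def\<close>)
  then show ?thesis
    using that[of "I k"] I k small[of k] n by (auto simp: I_def)
qed

lemma truncation_tendsto:
  fixes f :: "real \<Rightarrow> real"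
  assumes f: "square_integrable f"
  shows "(\<lambda>n. abs_l2 (\<lambda>t. if \<bar>f t\<bar> \<le> real n then f t else 0)) \<longlonglongrightarrow> abs_l2 f"
proof -
  define g where "g n t = (if \<bar>f t\<bar> \<le> real n then f t else 0)" for n t
  have [measurable]: "f \<in> borel_measurable unit_leb" using f by (simp add: square_integrable_def)
  have gm [measurable]: "g n \<in> borel_measurable unit_leb" for n unfolding g_def by measurable
  have "integrable unit_leb (\<lambda>t. (norm (g n t))\<^sup>2)" for n
    by (rule Bochner_Integration.integrable_bound[of _ "\<lambda>t. (norm (f t))\<^sup>2"])
       (use f in \<open>auto simp: square_integrable_def g_def\<close>)
  then have g: "square_integrable (g n)" for n by (simp add: square_integrable_def)
  have "(\<lambda>n. \<integral>t. (norm (g n t - f t))\<^sup>2 \<partial>unit_leb) \<longlonglongrightarrow> (\<integral>t. 0 \<partial>unit_leb)"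
  proof (rule integral_dominated_convergence)
    show "integrable unit_leb (\<lambda>t. (norm (f t))\<^sup>2)" using f by (simp add: square_integrable_def)
    have "\<forall>\<^sub>F n in sequentially. (norm (g n t - f t))\<^sup>2 = 0" for t
      using eventually_ge_at_top[of "nat \<lceil>\<bar>f t\<bar>\<rceil>"]
      by eventually_elim (auto simp: g_def)
    then show "AE t in unit_leb. (\<lambda>n. (norm (g n t - f t))\<^sup>2) \<longlonglongrightarrow> 0"
      by (intro AE_I2 tendsto_eventually)
    show "AE t in unit_leb. norm ((norm (g n t - f t))\<^sup>2) \<le> (norm (f t))\<^sup>2" for n
      by (auto simp: g_def)
  qed auto
  then have "(\<lambda>n. l2norm (\<lambda>t. g n t - f t)) \<longlonglongrightarrow> 0"
    unfolding l2norm_def using tendsto_real_sqrt by fastforce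
  then have "(\<lambda>n. norm (abs_l2 (g n) - abs_l2 f)) \<longlonglongrightarrow> 0"
    using f g by (simp add: abs_l2_algebra square_integrable_diff)
  then show ?thesis
    by (subst (asm) tendsto_norm_zero_iff) (simp add: g_def[abs_def] LIM_zero_iff)
qed

text \<open>A vector that violates the lower estimate may be unbounded, but the violation is an open condition and
  thus survives truncation.\<close>

lemma bounded_almost_kernel:
  fixes T :: "real l2 \<Rightarrow> 'w::real_normed_vector"
  assumes T: "bounded_linear T" and B: "B \<in> sets unit_leb"
    and not_emb: "\<not> isomorphic_embedding_on (L2_on B) T" and \<delta>: "\<delta> > 0"
  obtains f M where "bounded_on B M f" "norm (T (abs_l2 f)) < \<delta> * norm (abs_l2 f)"
proof -
  obtain x where x: "x \<in> L2_on B" "norm (T x) < \<delta> * norm x"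
    using not_emb \<delta> by (force simp: isomorphic_embedding_on_def not_le)
  obtain g where g: "square_integrable g" "x = abs_l2 g" by (rule l2_cases)
  have [measurable]: "g \<in> borel_measurable unit_leb" "B \<in> sets unit_leb"
    using g B by (auto simp: square_integrable_def)
  define h where "h t = indicator B t * g t" for t
  have [measurable]: "h \<in> borel_measurable unit_leb" unfolding h_def by measurable
  have "integrable unit_leb (\<lambda>t. (norm (h t))\<^sup>2)"
    by (rule Bochner_Integration.integrable_bound[of _ "\<lambda>t. (norm (g t))\<^sup>2"])
       (use g in \<open>auto simp: square_integrable_def h_def indicator_def\<close>)
  then have h: "square_integrable h" by (simp add: square_integrable_def)
  have "AE t in unit_leb. t \<notin> B \<longrightarrow> g t = 0"
    using x(1) g by (simp add: L2_on_def vanishes_outside.abs_eq)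
  then have "AE t in unit_leb. g t = h t"
    by eventually_elim (auto simp: h_def indicator_def)
  then have xh: "x = abs_l2 h" using abs_l2_eqI[OF g(1) h] g(2) by simp
  define k where "k n t = (if \<bar>h t\<bar> \<le> real n then h t else 0)" for n t
  have k: "bounded_on B (real n) (k n)" for n
    unfolding bounded_on_def k_def by (auto simp: h_def indicator_def)
  have lim: "(\<lambda>n. abs_l2 (k n)) \<longlonglongrightarrow> x"
    using truncation_tendsto[OF h] by (simp add: k_def[abs_def] xh)
  have "(\<lambda>n. norm (T (abs_l2 (k n))) - \<delta> * norm (abs_l2 (k n))) \<longlonglongrightarrow> norm (T x) - \<delta> * norm x"
    by (intro tendsto_intros bounded_linear.tendsto[OF T] lim)
  then have "\<forall>\<^sub>F n in sequentially. norm (T (abs_l2 (k n))) - \<delta> * norm (abs_l2 (k n)) < 0"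
    using x(2) by (intro order_tendstoD) auto
  then obtain n where "norm (T (abs_l2 (k n))) < \<delta> * norm (abs_l2 (k n))"
    by (auto simp: eventually_sequentially)
  then show ?thesis using that[OF k] by blast
qed

text \<open>The mean is removed by combining two almost kernel functions with disjoint supports in \<open>B\<close>. By
  disjointness neither summand is longer than the sum, so that \<open>\<delta>/2\<close> for each of them gives \<open>\<delta>\<close>
  for the sum.\<close>

lemma bounded_mean_zero_almost_kernel:
  fixes T :: "real l2 \<Rightarrow> 'w::real_normed_vector"
  assumes T: "bounded_linear T"
    and not_emb: "\<And>C. C \<in> sets unit_leb \<Longrightarrow> measure unit_leb C > 0 \<Longrightarrow> \<not> isomorphic_embedding_on (L2_on C) T"
    and B: "B \<in> sets unit_leb" "measure unit_leb B > 0" and \<delta>: "\<delta> > 0" and \<eta>: "\<eta> > 0"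
  obtains f where "bounded_on B \<eta> f" "integral\<^sup>L unit_leb f = 0" "abs_l2 f \<noteq> 0"
    "norm (T (abs_l2 f)) \<le> \<delta> * norm (abs_l2 f)"
proof -
  obtain C where C: "C \<in> sets unit_leb" "C \<subseteq> B" "measure unit_leb C > 0" "measure unit_leb (B - C) > 0"
    using split_positive_measure[OF B] .
  have BC: "B - C \<in> sets unit_leb" using B C by auto
  obtain f M where f: "bounded_on C M f" "norm (T (abs_l2 f)) < \<delta>/2 * norm (abs_l2 f)"
    using bounded_almost_kernel[OF T C(1) not_emb[OF C(1,3)] half_gt_zero[OF \<delta>]] .
  obtain g N where g: "bounded_on (B - C) N g" "norm (T (abs_l2 g)) < \<delta>/2 * norm (abs_l2 g)"
    using bounded_almost_kernel[OF T BC not_emb[OF BC C(4)] half_gt_zero[OF \<delta>]] .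
  note fi = bounded_on_integrable[OF f(1)] and gi = bounded_on_integrable[OF g(1)]
  have nz: "abs_l2 f \<noteq> 0" "abs_l2 g \<noteq> 0"
    using f(2) g(2) T by (auto simp: bounded_linear.linear linear_0)
  have "\<exists>a b. (a \<noteq> 0 \<or> b \<noteq> 0) \<and> a * integral\<^sup>L unit_leb f + b * integral\<^sup>L unit_leb g = 0"
  proof (cases "integral\<^sup>L unit_leb f = 0")
    case True
    then show ?thesis by (intro exI[of _ 1] exI[of _ 0]) auto
  next
    case False
    then show ?thesis
      by (intro exI[of _ "integral\<^sup>L unit_leb g"] exI[of _ "- integral\<^sup>L unit_leb f"]) auto
  qed
  then obtain a b where ab: "a \<noteq> 0 \<or> b \<noteq> 0"
    "a * integral\<^sup>L unit_leb f + b * integral\<^sup>L unit_leb g = 0" by blast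
  define u where "u t = a *\<^sub>R f t + b *\<^sub>R g t" for t
  define L where "L = \<bar>a\<bar> * \<bar>M\<bar> + \<bar>b\<bar> * \<bar>N\<bar> + 1"
  have L: "L > 0" by (simp add: L_def add_nonneg_pos)
  have sq: "square_integrable (\<lambda>t. a *\<^sub>R f t)" "square_integrable (\<lambda>t. b *\<^sub>R g t)"
    by (intro square_integrable_scaleR fi gi)+
  have su: "square_integrable u" unfolding u_def by (rule square_integrable_add[OF sq])
  have u: "abs_l2 u = a *\<^sub>R abs_l2 f + b *\<^sub>R abs_l2 g"
    using fi gi sq by (simp add: abs_l2_algebra u_def[abs_def])
  have supp: "f t = 0 \<or> g t = 0" for t
    using bounded_on_eq_0[OF f(1)] bounded_on_eq_0[OF g(1)] by auto
  have le: "norm (a *\<^sub>R f t) \<le> norm (u t)" "norm (b *\<^sub>R g t) \<le> norm (u t)" for t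
    using supp[of t] by (auto simp: u_def)
  have "norm (a *\<^sub>R abs_l2 f) \<le> norm (abs_l2 u)" "norm (b *\<^sub>R abs_l2 g) \<le> norm (abs_l2 u)"
    unfolding abs_l2_algebra(3)[OF fi(2) fi(2)] abs_l2_algebra(3)[OF gi(2) gi(2)]
      abs_l2_algebra(4)[OF su su] abs_l2_algebra(4)[OF sq(1) su] abs_l2_algebra(4)[OF sq(2) su]
    by (intro l2norm_mono sq su AE_I2 le)+
  then have nu: "\<bar>a\<bar> * norm (abs_l2 f) \<le> norm (abs_l2 u)" "\<bar>b\<bar> * norm (abs_l2 g) \<le> norm (abs_l2 u)"
    by auto
  have u0: "abs_l2 u \<noteq> 0"
    using nu ab(1) nz by (auto simp: mult_le_0_iff)
  have "norm (T (abs_l2 u)) \<le> \<bar>a\<bar> * norm (T (abs_l2 f)) + \<bar>b\<bar> * norm (T (abs_l2 g))"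
    unfolding u using T norm_triangle_ineq[of "a *\<^sub>R T (abs_l2 f)" "b *\<^sub>R T (abs_l2 g)"]
    by (simp add: bounded_linear.linear linear_add linear_scale)
  also have "\<dots> \<le> \<bar>a\<bar> * (\<delta>/2 * norm (abs_l2 f)) + \<bar>b\<bar> * (\<delta>/2 * norm (abs_l2 g))"
    using f(2) g(2) by (intro add_mono mult_left_mono) auto
  also have "\<dots> = \<delta>/2 * (\<bar>a\<bar> * norm (abs_l2 f)) + \<delta>/2 * (\<bar>b\<bar> * norm (abs_l2 g))" by (simp add: mult.left_commute)
  also have "\<dots> \<le> \<delta>/2 * norm (abs_l2 u) + \<delta>/2 * norm (abs_l2 u)"
    using nu \<delta> by (intro add_mono mult_left_mono) auto
  finally have Tu: "norm (T (abs_l2 u)) \<le> \<delta> * norm (abs_l2 u)" by simp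
  have um [measurable]: "u \<in> borel_measurable unit_leb" using su by (simp add: square_integrable_def)
  have ub: "\<bar>u t\<bar> \<le> L * indicator B t" for t
  proof -
    have "\<bar>a\<bar> * \<bar>f t\<bar> + \<bar>b\<bar> * \<bar>g t\<bar> \<le> \<bar>a\<bar> * (\<bar>M\<bar> * indicator B t) + \<bar>b\<bar> * (\<bar>N\<bar> * indicator B t)"
      using bounded_on_bound[OF f(1) C(2)] bounded_on_bound[OF g(1) Diff_subset]
      by (intro add_mono mult_left_mono) auto
    also have "\<dots> \<le> L * indicator B t" by (auto simp: L_def indicator_def)
    finally show ?thesis
      using abs_triangle_ineq[of "a * f t" "b * g t"] by (simp add: u_def abs_mult)
  qed
  define s where "s t = (\<eta> / L) *\<^sub>R u t" for t
  have s: "abs_l2 s = (\<eta> / L) *\<^sub>R abs_l2 u"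
    using su by (simp add: s_def[abs_def] abs_l2_algebra)
  show ?thesis
  proof (rule that)
    have "\<bar>s t\<bar> \<le> \<eta> * indicator B t" for t
      using mult_left_mono[OF ub, of "\<eta> / L" t] L \<eta> by (simp add: s_def abs_mult)
    then show "bounded_on B \<eta> s" by (auto simp: bounded_on_def s_def[abs_def])
    show "integral\<^sup>L unit_leb s = 0"
    proof -
      have "integral\<^sup>L unit_leb s = (\<eta> / L) * (a * integral\<^sup>L unit_leb f + b * integral\<^sup>L unit_leb g)"
        unfolding s_def[abs_def] u_def using fi gi by simp
      then show ?thesis using ab(2) by simp
    qed
    show "abs_l2 s \<noteq> 0" using u0 L \<eta> by (simp add: s)
    show "norm (T (abs_l2 s)) \<le> \<delta> * norm (abs_l2 s)"
      using Tu L \<eta> T by (simp add: s bounded_linear.linear linear_scale field_simps)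
  qed
qed

section \<open>Signs with small image\<close>

text \<open>The norm dominates the $L_1$ norm, so a subsequence converges almost everywhere; the uniform bound
  turns this back into convergence in norm and of the means.\<close>

lemma bounded_Cauchy_limit:
  fixes f :: "nat \<Rightarrow> real \<Rightarrow> real"
  assumes f: "\<And>n. bounded_on A 1 (f n)" and Cauchy: "Cauchy (\<lambda>n. abs_l2 (f n))"
  obtains r g where "strict_mono r" "bounded_on A 1 g" "AE t in unit_leb. (\<lambda>i. f (r i) t) \<longlonglongrightarrow> g t"
    "(\<lambda>i. abs_l2 (f (r i))) \<longlonglongrightarrow> abs_l2 g"
    "(\<lambda>i. integral\<^sup>L unit_leb (f (r i))) \<longlonglongrightarrow> integral\<^sup>L unit_leb g"
proof -
  have fm [measurable]: "f n \<in> borel_measurable unit_leb" for n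
    using f by (simp add: bounded_on_def)
  note fi = bounded_on_integrable[OF f]
  have L1: "\<exists>N. \<forall>i\<ge>N. \<forall>j\<ge>N. (LINT t|unit_leb. norm (f i t - f j t)) < e" if e: "e > 0" for e
  proof -
    obtain N where N: "\<And>i j. i \<ge> N \<Longrightarrow> j \<ge> N \<Longrightarrow> norm (abs_l2 (f i) - abs_l2 (f j)) < e / 2"
      using Cauchy e unfolding Cauchy_def dist_norm by (meson half_gt_zero)
    have "(LINT t|unit_leb. norm (f i t - f j t)) < e" if ij: "i \<ge> N" "j \<ge> N" for i j
    proof -
      define h where "h t = f i t - f j t" for t
      have h: "square_integrable h" "integrable unit_leb h"
        unfolding h_def using fi by (auto intro: square_integrable_diff)
      have h2: "integrable unit_leb (\<lambda>t. (norm (h t))\<^sup>2)" using h by (simp add: square_integrable_def)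
      have "(\<integral>t. (norm (h t))\<^sup>2 \<partial>unit_leb) = (norm (abs_l2 (f i) - abs_l2 (f j)))\<^sup>2"
        using fi h by (simp add: abs_l2_algebra l2norm_sq h_def[abs_def])
      also have "\<dots> < (e / 2)\<^sup>2"
        using N[OF ij] by (intro power_strict_mono) auto
      finally have h3: "(\<integral>t. (norm (h t))\<^sup>2 \<partial>unit_leb) < (e / 2)\<^sup>2" .
      \<comment> \<open>This elementary bound replaces the Cauchy-Schwarz inequality.\<close>
      have "norm x \<le> e / 4 + (norm x)\<^sup>2 / e" for x :: real
      proof -
        have "0 \<le> (norm x - e / 2)\<^sup>2 / e" using e by simp
        also have "\<dots> = e / 4 + (norm x)\<^sup>2 / e - norm x"
          using e by (simp add: power2_eq_square field_simps)
        finally show ?thesis by simp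
      qed
      then have "(\<integral>t. norm (h t) \<partial>unit_leb) \<le> (\<integral>t. e / 4 + (norm (h t))\<^sup>2 / e \<partial>unit_leb)"
        using h h2 by (intro integral_mono) auto
      also have "\<dots> = e / 4 + (\<integral>t. (norm (h t))\<^sup>2 \<partial>unit_leb) / e"
        using h2 measure_unit_leb_unit_interval by simp
      also have "\<dots> < e / 4 + (e / 2)\<^sup>2 / e"
        using h3 e by (simp add: divide_strict_right_mono)
      also have "\<dots> \<le> e" using e by (simp add: power2_eq_square field_simps)
      finally show ?thesis by (simp add: h_def)
    qed
    then show ?thesis by blast
  qed
  obtain r where r: "strict_mono r" "AE t in unit_leb. Cauchy (\<lambda>i. f (r i) t)"
    using cauchy_L1_AE_cauchy_subseq[OF fi(1) L1] by blast
  define g where "g t = (if t \<in> {0..1} \<and> Cauchy (\<lambda>i. f (r i) t) then lim (\<lambda>i. f (r i) t) else 0)" for t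
  have lim: "AE t in unit_leb. (\<lambda>i. f (r i) t) \<longlonglongrightarrow> g t"
    using r(2) AE_space
  proof eventually_elim
    case (elim t)
    then show ?case by (simp add: g_def convergent_LIMSEQ_iff[symmetric] Cauchy_convergent_iff)
  qed
  have "(\<lambda>t. if Cauchy (\<lambda>i. f (r i) t) then lim (\<lambda>i. f (r i) t) else 0) \<in> borel_measurable unit_leb"
    by measurable
  then have gm [measurable]: "g \<in> borel_measurable unit_leb"
    by (subst measurable_cong[of _ g]) (auto simp: g_def)
  have "\<bar>g t\<bar> \<le> 1 * indicator A t" for t
  proof (cases "t \<in> {0..1} \<and> Cauchy (\<lambda>i. f (r i) t)")
    case True
    then have "(\<lambda>i. f (r i) t) \<longlonglongrightarrow> g t"
      by (simp add: g_def convergent_LIMSEQ_iff[symmetric] Cauchy_convergent_iff)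
    then have "(\<lambda>i. \<bar>f (r i) t\<bar>) \<longlonglongrightarrow> \<bar>g t\<bar>" by (rule tendsto_rabs)
    then show ?thesis
      by (rule LIMSEQ_le_const2) (use f in \<open>auto simp: bounded_on_def\<close>)
  qed (auto simp: g_def)
  then have g: "bounded_on A 1 g" by (auto simp: bounded_on_def)
  note gi = bounded_on_integrable[OF g]
  have le1: "\<bar>f n t\<bar> \<le> 1" "\<bar>g t\<bar> \<le> 1" for n t
    using bounded_on_bound[OF f, of UNIV n t] bounded_on_bound[OF g, of UNIV t] by auto
  have I: "(\<lambda>i. integral\<^sup>L unit_leb (f (r i))) \<longlonglongrightarrow> integral\<^sup>L unit_leb g"
    by (rule integral_dominated_convergence[where w = "\<lambda>_. 1"]) (use lim le1 in auto)
  have "(\<lambda>i. \<integral>t. (norm (f (r i) t - g t))\<^sup>2 \<partial>unit_leb) \<longlonglongrightarrow> (\<integral>t. 0 \<partial>unit_leb)"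
  proof (rule integral_dominated_convergence[where w = "\<lambda>_. 4"])
    show "AE t in unit_leb. (\<lambda>i. (norm (f (r i) t - g t))\<^sup>2) \<longlonglongrightarrow> 0"
      using lim
    proof eventually_elim
      case (elim t)
      then have "(\<lambda>i. (norm (f (r i) t - g t))\<^sup>2) \<longlonglongrightarrow> (norm (g t - g t))\<^sup>2"
        by (intro tendsto_intros)
      then show ?case by simp
    qed
    show "AE t in unit_leb. norm ((norm (f (r i) t - g t))\<^sup>2) \<le> 4" for i
    proof (rule AE_I2)
      fix t
      have "norm (f (r i) t - g t) \<le> 2" using le1(1)[of "r i" t] le1(2)[of t] by auto
      then have "(norm (f (r i) t - g t))\<^sup>2 \<le> 2\<^sup>2" by (rule power_mono) simp
      then show "norm ((norm (f (r i) t - g t))\<^sup>2) \<le> 4" by simp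
    qed
  qed auto
  then have "(\<lambda>i. l2norm (\<lambda>t. f (r i) t - g t)) \<longlonglongrightarrow> 0"
    unfolding l2norm_def using tendsto_real_sqrt by fastforce
  then have "(\<lambda>i. norm (abs_l2 (f (r i)) - abs_l2 g)) \<longlonglongrightarrow> 0"
    using fi gi by (simp add: abs_l2_algebra square_integrable_diff)
  then have "(\<lambda>i. abs_l2 (f (r i))) \<longlonglongrightarrow> abs_l2 g"
    by (subst (asm) tendsto_norm_zero_iff) (simp add: LIM_zero_iff)
  then show ?thesis using that r(1) g lim I by blast
qed

text \<open>Convergence almost everywhere yields sets on which a whole tail of the sequence stays away from
  \<open>-1\<close> and \<open>1\<close>. If such a set had positive measure, a single nonzero step would remain available along
  the tail, although the available steps shrink to zero.\<close>

proposition mean_zero_sign_with_small_image: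
  fixes T :: "real l2 \<Rightarrow> real l2"
  assumes T: "bounded_linear T"
    and not_emb: "\<And>C. C \<in> sets unit_leb \<Longrightarrow> measure unit_leb C > 0 \<Longrightarrow> \<not> isomorphic_embedding_on (L2_on C) T"
    and A: "A \<in> sets unit_leb" and \<epsilon>: "\<epsilon> > 0"
  obtains g where "bounded_on A 1 g" "AE t in unit_leb. t \<in> A \<longrightarrow> \<bar>g t\<bar> = 1"
    "integral\<^sup>L unit_leb g = 0" "norm (T (abs_l2 g)) < \<epsilon>"
proof -
  define D where "D = {abs_l2 f | f. bounded_on A 1 f \<and> integral\<^sup>L unit_leb f = 0}"
  define \<delta> where "\<delta> = \<epsilon> / 4"
  have \<delta>: "\<delta> > 0" using \<epsilon> by (simp add: \<delta>_def)
  interpret coin_walk T \<delta> D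
  proof (rule coin_walk.intro)
    have "bounded_on A 1 (\<lambda>_. 0)" by (simp add: bounded_on_def)
    then show "0 \<in> D" by (force simp: D_def zero_l2.abs_eq)
    show "norm x \<le> 1" if x: "x \<in> D" for x
    proof -
      obtain f where f: "bounded_on A 1 f" "x = abs_l2 f" using x by (auto simp: D_def)
      have one: "bounded_on UNIV 1 (\<lambda>_. 1)" by (simp add: bounded_on_def)
      have "l2norm f \<le> l2norm (\<lambda>_. 1 :: real)"
        using bounded_on_bound[OF f(1), of UNIV]
        by (intro l2norm_mono bounded_on_integrable[OF f(1)] bounded_on_integrable[OF one]) auto
      also have "\<dots> = 1" using measure_unit_leb_unit_interval by (simp add: l2norm_def)
      finally show ?thesis using f bounded_on_integrable[OF f(1)] by (simp add: abs_l2_algebra)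
    qed
  qed (rule T \<delta> l2_parallelogram)+
  obtain y where y: "\<And>n. y n \<in> D" "Cauchy y" "\<And>n. norm (T (y n)) \<le> 3 * \<delta>"
    and exhausted: "\<And>e. e > 0 \<Longrightarrow> \<exists>N. \<forall>n\<ge>N. \<forall>s\<in>steps (y n). norm s < e"
    using exhausted_sequence by blast
  have "\<forall>n. \<exists>f. y n = abs_l2 f \<and> bounded_on A 1 f \<and> integral\<^sup>L unit_leb f = 0"
    using y(1) by (auto simp: D_def)
  then obtain f where f: "\<And>n. y n = abs_l2 (f n)" "\<And>n. bounded_on A 1 (f n)"
      "\<And>n. integral\<^sup>L unit_leb (f n) = 0" by metis
  have "Cauchy (\<lambda>n. abs_l2 (f n))" using y(2) ext[of y, OF f(1)] by simp
  then obtain r g where r: "strict_mono r" and g: "bounded_on A 1 g"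
    and ae: "AE t in unit_leb. (\<lambda>i. f (r i) t) \<longlonglongrightarrow> g t"
    and lim: "(\<lambda>i. abs_l2 (f (r i))) \<longlonglongrightarrow> abs_l2 g"
    and lim_int: "(\<lambda>i. integral\<^sup>L unit_leb (f (r i))) \<longlonglongrightarrow> integral\<^sup>L unit_leb g"
    by (rule bounded_Cauchy_limit[OF f(2)])
  have [measurable]: "f n \<in> borel_measurable unit_leb" "A \<in> sets unit_leb" for n
    using f(2) A by (auto simp: bounded_on_def)
  \<comment> \<open>If the limit is strictly between -1 and 1 at a point of \<open>A\<close> where the sequence
    converges, then the point lies in some \<open>E k\<close>. An almost kernel function on \<open>E k\<close> with mean zero
    and bounded by \<open>1 / Suc k\<close> is a step at all \<open>y (r i)\<close> with \<open>i \<ge> k\<close>.\<close>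
  define E where "E k = {t\<in>A. \<forall>i\<ge>k. \<bar>f (r i) t\<bar> \<le> 1 - 1 / real (Suc k)}" for k
  have Em: "E k \<in> sets unit_leb" for k
  proof -
    have "E k = {t\<in>space unit_leb. t \<in> A \<and> (\<forall>i\<in>{k..}. \<bar>f (r i) t\<bar> \<le> 1 - 1 / real (Suc k))}"
      using sets.sets_into_space[OF A] by (auto simp: E_def)
    also have "\<dots> \<in> sets unit_leb" by measurable
    finally show ?thesis .
  qed
  have null: "measure unit_leb (E k) = 0" for k
  proof (rule ccontr)
    assume "measure unit_leb (E k) \<noteq> 0"
    then have "measure unit_leb (E k) > 0" by (simp add: less_le)
    then obtain h where h: "bounded_on (E k) (1 / real (Suc k)) h" "integral\<^sup>L unit_leb h = 0"
        "abs_l2 h \<noteq> 0" "norm (T (abs_l2 h)) \<le> \<delta> * norm (abs_l2 h)"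
      using bounded_mean_zero_almost_kernel[OF T not_emb Em _ \<delta>, of k "1 / real (Suc k)"] by auto
    have step: "abs_l2 h \<in> steps (y (r i))" if "i \<ge> k" for i
    proof -
      have b: "bounded_on A 1 (\<lambda>t. f (r i) t + c * h t)" if c: "\<bar>c\<bar> = 1" for c
      proof -
        have "\<bar>f (r i) t + c * h t\<bar> \<le> 1 * indicator A t" for t
        proof (cases "t \<in> E k")
          case True
          then have "\<bar>f (r i) t\<bar> \<le> 1 - 1 / real (Suc k)" "t \<in> A" using \<open>i \<ge> k\<close> by (auto simp: E_def)
          moreover have "\<bar>h t\<bar> \<le> 1 / real (Suc k)"
            using h(1) True by (auto simp: bounded_on_def dest!: spec[of _ t])
          ultimately show ?thesis
            using abs_triangle_ineq[of "f (r i) t" "c * h t"] c by (simp add: abs_mult)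
        next
          case False
          then have "h t = 0" by (rule bounded_on_eq_0[OF h(1)])
          then show ?thesis using f(2)[of "r i"] by (simp add: bounded_on_def)
        qed
        then show ?thesis using h(1) by (auto simp: bounded_on_def)
      qed
      note hi = bounded_on_integrable[OF h(1)] and fi = bounded_on_integrable[OF f(2)[of "r i"]]
      have "y (r i) + abs_l2 h = abs_l2 (\<lambda>t. f (r i) t + 1 * h t)"
        "y (r i) - abs_l2 h = abs_l2 (\<lambda>t. f (r i) t + (-1) * h t)"
        using hi fi by (simp_all add: f(1) abs_l2_algebra)
      moreover have "abs_l2 (\<lambda>t. f (r i) t + c * h t) \<in> D" if "\<bar>c\<bar> = 1" for c
      proof -
        have "integral\<^sup>L unit_leb (\<lambda>t. f (r i) t + c * h t) = 0"
          using hi fi h(2) f(3)[of "r i"] by simp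
        then show ?thesis using b[OF that] by (auto simp: D_def)
      qed
      from this[of 1] this[of "-1"]
      have "abs_l2 (\<lambda>t. f (r i) t + 1 * h t) \<in> D" "abs_l2 (\<lambda>t. f (r i) t + (-1) * h t) \<in> D"
        by simp_all
      ultimately show ?thesis using h(4) unfolding steps_def by simp
    qed
    obtain N where N: "\<And>n s. n \<ge> N \<Longrightarrow> s \<in> steps (y n) \<Longrightarrow> norm s < norm (abs_l2 h)"
      using exhausted[of "norm (abs_l2 h)"] h(3) by auto
    have "r (max k N) \<ge> N" using seq_suble[OF r, of "max k N"] by simp
    then show False using N[OF _ step[of "max k N"]] by simp
  qed
  have "AE t in unit_leb. \<forall>k. t \<notin> E k"
    unfolding AE_all_countable
  proof
    fix k
    have "E k \<in> null_sets unit_leb"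
      using Em null[of k] by (intro null_setsI) (auto simp: unit_leb.emeasure_eq_measure)
    then show "AE t in unit_leb. t \<notin> E k" by (rule AE_not_in)
  qed
  then have sign: "AE t in unit_leb. t \<in> A \<longrightarrow> \<bar>g t\<bar> = 1"
    using ae
  proof eventually_elim
    case (elim t)
    show ?case
    proof (intro impI, rule ccontr)
      assume t: "t \<in> A" "\<bar>g t\<bar> \<noteq> 1"
      have "\<bar>g t\<bar> \<le> 1" using g t(1) by (auto simp: bounded_on_def dest!: spec[of _ t])
      then have d: "0 < (1 - \<bar>g t\<bar>) / 2" using t by simp
      have "(\<lambda>i. \<bar>f (r i) t\<bar>) \<longlonglongrightarrow> \<bar>g t\<bar>" using elim(2) by (rule tendsto_rabs)
      then have "\<forall>\<^sub>F i in sequentially. \<bar>f (r i) t\<bar> < 1 - (1 - \<bar>g t\<bar>) / 2"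
        using d by (intro order_tendstoD) (auto simp: field_simps)
      then obtain n where n: "\<And>i. i \<ge> n \<Longrightarrow> \<bar>f (r i) t\<bar> < 1 - (1 - \<bar>g t\<bar>) / 2"
        by (auto simp: eventually_sequentially)
      obtain m where m: "1 / real (Suc m) < (1 - \<bar>g t\<bar>) / 2"
        using d nat_approx_posE by blast
      have le: "1 / real (Suc (max n m)) \<le> 1 / real (Suc m)" by (intro divide_left_mono) auto
      have "\<bar>f (r i) t\<bar> \<le> 1 - 1 / real (Suc (max n m))" if "i \<ge> max n m" for i
      proof -
        have "\<bar>f (r i) t\<bar> < 1 - (1 - \<bar>g t\<bar>) / 2" using n that by simp
        with le m show ?thesis by linarith
      qed
      then have "t \<in> E (max n m)" using t(1) by (simp add: E_def)
      then show False using elim(1) by blast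
    qed
  qed
  have "(\<lambda>i. norm (T (abs_l2 (f (r i))))) \<longlonglongrightarrow> norm (T (abs_l2 g))"
    by (intro tendsto_intros bounded_linear.tendsto[OF T] lim)
  then have "norm (T (abs_l2 g)) \<le> 3 * \<delta>"
    by (rule LIMSEQ_le_const2) (use y(3) in \<open>auto simp: f(1)\<close>)
  then have "norm (T (abs_l2 g)) < \<epsilon>" using \<epsilon> by (simp add: \<delta>_def)
  moreover have "integral\<^sup>L unit_leb g = 0" using lim_int f(3) by (simp add: LIMSEQ_const_iff)
  ultimately show ?thesis using that g sign by blast
qed

lemma narrow_if_nowhere_embedding:
  fixes T :: "real l2 \<Rightarrow> real l2"
  assumes T: "bounded_linear T"
    and not_emb: "\<And>C. C \<in> sets unit_leb \<Longrightarrow> measure unit_leb C > 0 \<Longrightarrow> \<not> isomorphic_embedding_on (L2_on C) T"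
  shows "narrow T"
  unfolding narrow_def
proof (intro allI impI ballI)
  fix \<epsilon> :: real and A assume \<epsilon>: "\<epsilon> > 0" and A: "A \<in> sets unit_leb"
  obtain g where g: "bounded_on A 1 g" "AE t in unit_leb. t \<in> A \<longrightarrow> \<bar>g t\<bar> = 1"
    "integral\<^sup>L unit_leb g = 0" "norm (T (abs_l2 g)) < \<epsilon>"
    using mean_zero_sign_with_small_image[OF T not_emb A \<epsilon>] by blast
  have [measurable]: "g \<in> borel_measurable unit_leb" "A \<in> sets unit_leb"
    using g(1) A by (auto simp: bounded_on_def)
  \<comment> \<open>A sign takes its values everywhere, whereas \<open>g\<close> may lie strictly between -1 and 1 on a null
    subset of \<open>A\<close>.\<close>
  define f where "f t = indicator A t * (if g t \<ge> 0 then 1 else -1 :: real)" for t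
  have fm [measurable]: "f \<in> borel_measurable unit_leb" unfolding f_def by measurable
  have sign: "is_sign f" by (auto simp: is_sign_def f_def indicator_def)
  have eq: "AE t in unit_leb. f t = g t"
    using g(2)
  proof eventually_elim
    case (elim t)
    show ?case using elim bounded_on_bound[OF g(1) order_refl, of t]
      by (auto simp: f_def indicator_def)
  qed
  have "abs_l2 f = abs_l2 g"
    using eq by (intro abs_l2_eqI is_sign_square_integrable[OF sign] bounded_on_integrable[OF g(1)])
  moreover have "integral\<^sup>L unit_leb f = 0"
    using integral_cong_AE[OF _ _ eq] g(3) by simp
  moreover have "AE t in unit_leb. f t \<noteq> 0 \<longleftrightarrow> t \<in> A" by (auto simp: f_def indicator_def)
  ultimately show "\<exists>f. is_sign f \<and> (AE t in unit_leb. f t \<noteq> 0 \<longleftrightarrow> t \<in> A) \<and>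
      integral\<^sup>L unit_leb f = 0 \<and> norm (T (abs_l2 f)) < \<epsilon>"
    using sign g(4) by (intro exI[of _ f]) auto
qed

lemma narrow_not_embedding:
  fixes T :: "'a::{real_normed_field,banach,second_countable_topology} l2 \<Rightarrow> 'a l2"
  assumes narrow: "narrow T" and A: "A \<in> sets unit_leb" "measure unit_leb A > 0"
  shows "\<not> isomorphic_embedding_on (L2_on A) T"
proof
  assume "isomorphic_embedding_on (L2_on A) T"
  then obtain c where c: "c > 0" "\<And>x. x \<in> L2_on A \<Longrightarrow> c * norm x \<le> norm (T x)"
    by (auto simp: isomorphic_embedding_on_def)
  have "c * sqrt (measure unit_leb A) > 0" using c(1) A(2) by simp
  then obtain f where f: "is_sign f" "AE t in unit_leb. f t \<noteq> 0 \<longleftrightarrow> t \<in> A"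
      "norm (T (abs_l2 f)) < c * sqrt (measure unit_leb A)"
    using narrow A(1) unfolding narrow_def by blast
  note sq = is_sign_square_integrable[OF f(1)]
  have fm [measurable]: "f \<in> borel_measurable unit_leb" using f(1) by (simp add: is_sign_def)
  have [measurable]: "A \<in> sets unit_leb" by (rule A)
  have "abs_l2 f \<in> L2_on A"
    using f(2) sq by (auto simp: L2_on_def vanishes_outside.abs_eq elim!: AE_mp)
  moreover have "norm (abs_l2 f) = sqrt (measure unit_leb A)"
  proof -
    have "AE t in unit_leb. (norm (f t))\<^sup>2 = indicator A t"
      using f(2) AE_space
    proof eventually_elim
      case (elim t)
      then have "f t \<in> {1, -1, 0}" using f(1) by (auto simp: is_sign_def)
      then show ?case using elim by (auto simp: indicator_def)
    qed
    then have "(\<integral>t. (norm (f t))\<^sup>2 \<partial>unit_leb) = (\<integral>t. indicator A t \<partial>unit_leb)"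
      by (intro integral_cong_AE) auto
    also have "\<dots> = measure unit_leb A"
      using sets.sets_into_space[OF A(1)] by (simp add: Int_absorb2)
    finally show ?thesis using sq by (simp add: abs_l2_algebra l2norm_def)
  qed
  ultimately show False using c(2)[of "abs_l2 f"] f(3) by simp
qed

theorem theorem2p1:
  shows "(\<forall>T :: real l2 \<Rightarrow> real l2. bounded_operator T \<longrightarrow>
            (narrow T \<longleftrightarrow>
              (\<forall>A\<in>sets unit_leb. measure unit_leb A > 0 \<longrightarrow> \<not> isomorphic_embedding_on (L2_on A) T)))
       \<and> (\<forall>T :: complex l2 \<Rightarrow> complex l2. bounded_operator T \<longrightarrow>
            (narrow T \<longrightarrow>
              (\<forall>A\<in>sets unit_leb. measure unit_leb A > 0 \<longrightarrow> \<not> isomorphic_embedding_on (L2_on A) T)))"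
proof (intro conjI allI impI iffI ballI)
  fix T :: "real l2 \<Rightarrow> real l2"
  assume "bounded_operator T"
    "\<forall>A\<in>sets unit_leb. measure unit_leb A > 0 \<longrightarrow> \<not> isomorphic_embedding_on (L2_on A) T"
  then show "narrow T" by (intro narrow_if_nowhere_embedding) (auto simp: bounded_operator_def)
qed (simp_all add: narrow_not_embedding)

end
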